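(* Let $n\ge 1$. The set $\mathcal U(n)=M(n)^\times\cup\{[0]\}$ is a submultiring of $M(n)$ if and only if $n=1$ or $n$ is prime.
   Context: For a positive integer $n$, $\mathbb Z_n=\mathbb Z/n\mathbb Z$, $\mathbb Z_n^\times$ is its group of units, and $S_n=\{u^2:u\in\mathbb Z_n^\times\}$. $M(n)$ denotes the Marshall quotient of $\mathbb Z_n$ by $S_n$: the underlying set is the quotient of $\mathbb Z_n$ by the equivalence relation $a\sim b\iff as=bt$ for some $s,t\in S_n$; the class of $a$ is written $[a]$. The operations are $[a][b]=[ab]$, $-[a]=[-a]$, and the multivalued addition $[a]+[b]=\{[c]: cr=as+bt\text{ for some }r,s,t\in S_n\}$, with zero $[0]$ and unit $[1]$; with these $M(n)$ is a commutative multiring. $M(n)^\times$ denotes the set of invertible elements of $M(n)$, i.e. those $x\in M(n)$ for which there is $y\in M(n)$ with $xy=[1]$. A subset $T$ of a multiring $R$ is a submultiring if $0,1\in T$, $T$ is closed under multiplication and $x\mapsto -x$, and $T$ is closed under the multivalued addition: $x+y\subseteq T$ (the sum being computed in $R$) for all $x,y\in T$. *)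

theory Defs
  imports "HOL-Algebra.IntRing"
begin

text \<open>
  The signature of a commutative multiring. It extends the library's monoid record, so that
  \<^term>\<open>Units\<close> is available for the multiplication; \<open>hadd\<close> is the multivalued addition.
\<close>

record 'a multiring = "'a monoid" +
  hzero :: 'a
  hneg :: "'a \<Rightarrow> 'a"
  hadd :: "'a \<Rightarrow> 'a \<Rightarrow> 'a set"

definition submultiring :: "'a set \<Rightarrow> ('a, 'b) multiring_scheme \<Rightarrow> bool" where
  "submultiring T M \<longleftrightarrow>
     T \<subseteq> carrier M \<and>
     hzero M \<in> T \<and> \<one>\<^bsub>M\<^esub> \<in> T \<and>
     (\<forall>x\<in>T. \<forall>y\<in>T. x \<otimes>\<^bsub>M\<^esub> y \<in> T) \<and>
     (\<forall>x\<in>T. hneg M x \<in> T) \<and>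
     (\<forall>x\<in>T. \<forall>y\<in>T. hadd M x y \<subseteq> T)"

definition marshall_rel :: "('a, 'b) ring_scheme \<Rightarrow> 'a set \<Rightarrow> ('a \<times> 'a) set" where
  "marshall_rel R S =
     {(a, b). a \<in> carrier R \<and> b \<in> carrier R \<and> (\<exists>s\<in>S. \<exists>t\<in>S. a \<otimes>\<^bsub>R\<^esub> s = b \<otimes>\<^bsub>R\<^esub> t)}"

abbreviation marshall_class :: "('a, 'b) ring_scheme \<Rightarrow> 'a set \<Rightarrow> 'a \<Rightarrow> 'a set" where
  "marshall_class R S a \<equiv> marshall_rel R S `` {a}"

text \<open>
  The operations on classes are written without choosing representatives, in the manner of
  \<^const>\<open>rcoset_mult\<close>; the lemmas \<open>marshall_quotient_mult\<close>, \<open>marshall_quotient_neg\<close> and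
  \<open>marshall_quotient_add\<close> below give them in terms of arbitrary representatives.
\<close>

definition marshall_quotient :: "('a, 'b) ring_scheme \<Rightarrow> 'a set \<Rightarrow> 'a set multiring" where
  "marshall_quotient R S =
     \<lparr>carrier = carrier R // marshall_rel R S,
      mult = (\<lambda>A B. \<Union>a\<in>A. \<Union>b\<in>B. marshall_class R S (a \<otimes>\<^bsub>R\<^esub> b)),
      one = marshall_class R S \<one>\<^bsub>R\<^esub>,
      hzero = marshall_class R S \<zero>\<^bsub>R\<^esub>,
      hneg = (\<lambda>A. \<Union>a\<in>A. marshall_class R S (\<ominus>\<^bsub>R\<^esub> a)),
      hadd = (\<lambda>A B. {marshall_class R S c | c. c \<in> carrier R \<and>
        (\<exists>a\<in>A. \<exists>b\<in>B. \<exists>r\<in>S. \<exists>s\<in>S. \<exists>t\<in>S. c \<otimes>\<^bsub>R\<^esub> r = a \<otimes>\<^bsub>R\<^esub> s \<oplus>\<^bsub>R\<^esub> b \<otimes>\<^bsub>R\<^esub> t)})\<rparr>"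

definition unit_squares :: "('a, 'b) ring_scheme \<Rightarrow> 'a set" where
  "unit_squares R = {u [^]\<^bsub>R\<^esub> (2::nat) | u. u \<in> Units R}"

text \<open>
  The ring \<^term>\<open>ZFact (int n)\<close> is used for the integers modulo \<open>n\<close> because, unlike
  \<open>residue_ring\<close>, it is also correct for \<open>n = 1\<close>.
\<close>

definition \<M> :: "nat \<Rightarrow> int set set multiring" where
  "\<M> n = marshall_quotient (ZFact (int n)) (unit_squares (ZFact (int n)))"

definition \<U> :: "nat \<Rightarrow> int set set set" where
  "\<U> n = Units (\<M> n) \<union> {hzero (\<M> n)}"

context cring
begin

context
  fixes S
  assumes S: "S \<subseteq> carrier R" "\<one> \<in> S" "\<And>s t. s \<in> S \<Longrightarrow> t \<in> S \<Longrightarrow> s \<otimes> t \<in> S"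
begin

lemma marshall_relI:
  "a \<in> carrier R \<Longrightarrow> b \<in> carrier R \<Longrightarrow> s \<in> S \<Longrightarrow> t \<in> S \<Longrightarrow> a \<otimes> s = b \<otimes> t
    \<Longrightarrow> (a, b) \<in> marshall_rel R S"
  unfolding marshall_rel_def by blast

lemma marshall_relE:
  assumes "(a, b) \<in> marshall_rel R S"
  obtains s t where "a \<in> carrier R" "b \<in> carrier R" "s \<in> S" "t \<in> S"
    "s \<in> carrier R" "t \<in> carrier R" "a \<otimes> s = b \<otimes> t"
  using assms S(1) unfolding marshall_rel_def by blast

lemma equiv_marshall_rel: "equiv (carrier R) (marshall_rel R S)"
proof (rule equivI)
  show "marshall_rel R S \<subseteq> carrier R \<times> carrier R"
    unfolding marshall_rel_def by blast
  show "refl_on (carrier R) (marshall_rel R S)"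
    using S(2) by (auto intro!: refl_onI marshall_relI)
  show "sym (marshall_rel R S)"
    by (rule symI) (metis marshall_relE marshall_relI)
  show "trans (marshall_rel R S)"
  proof (rule transI)
    fix a b c assume "(a, b) \<in> marshall_rel R S" "(b, c) \<in> marshall_rel R S"
    then obtain s t u v where
      1: "a \<in> carrier R" "b \<in> carrier R" "s \<in> S" "t \<in> S" "s \<in> carrier R" "t \<in> carrier R"
        "a \<otimes> s = b \<otimes> t" and
      2: "c \<in> carrier R" "u \<in> S" "v \<in> S" "u \<in> carrier R" "v \<in> carrier R" "b \<otimes> u = c \<otimes> v"
      by (elim marshall_relE) metis
    have "a \<otimes> (s \<otimes> u) = (a \<otimes> s) \<otimes> u" using 1(1-6) 2(1-5) by (simp add: m_assoc)
    also have "\<dots> = (b \<otimes> u) \<otimes> t" unfolding 1(7) using 1(1-6) 2(1-5) by (simp add: m_ac)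
    also have "\<dots> = c \<otimes> (v \<otimes> t)" unfolding 2(6) using 1(1-6) 2(1-5) by (simp add: m_assoc)
    finally show "(a, c) \<in> marshall_rel R S"
      using 1 2 S(3) by (intro marshall_relI)
  qed
qed

lemma marshall_class_eq_iff:
  "a \<in> carrier R \<Longrightarrow> b \<in> carrier R \<Longrightarrow>
    marshall_class R S a = marshall_class R S b \<longleftrightarrow> (\<exists>s\<in>S. \<exists>t\<in>S. a \<otimes> s = b \<otimes> t)"
  using eq_equiv_class_iff[OF equiv_marshall_rel] unfolding marshall_rel_def by auto

lemma marshall_quotient_mult:
  assumes "a \<in> carrier R" "b \<in> carrier R"
  shows "marshall_class R S a \<otimes>\<^bsub>marshall_quotient R S\<^esub> marshall_class R S b
    = marshall_class R S (a \<otimes> b)"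
proof -
  have "congruent2 (marshall_rel R S) (marshall_rel R S) (\<lambda>a b. marshall_class R S (a \<otimes> b))"
  proof (rule congruent2I')
    fix a a' b b'
    assume "(a, a') \<in> marshall_rel R S" "(b, b') \<in> marshall_rel R S"
    then obtain s t u v where
      1: "a \<in> carrier R" "a' \<in> carrier R" "s \<in> S" "t \<in> S" "s \<in> carrier R" "t \<in> carrier R"
        "a \<otimes> s = a' \<otimes> t" and
      2: "b \<in> carrier R" "b' \<in> carrier R" "u \<in> S" "v \<in> S" "u \<in> carrier R" "v \<in> carrier R"
        "b \<otimes> u = b' \<otimes> v"
      by (elim marshall_relE) metis
    have "(a \<otimes> b) \<otimes> (s \<otimes> u) = (a \<otimes> s) \<otimes> (b \<otimes> u)" using 1(1-6) 2(1-6) by (simp add: m_ac)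
    also have "\<dots> = (a' \<otimes> t) \<otimes> (b' \<otimes> v)" using 1(7) 2(7) by simp
    also have "\<dots> = (a' \<otimes> b') \<otimes> (t \<otimes> v)" using 1(1-6) 2(1-6) by (simp add: m_ac)
    finally show "marshall_class R S (a \<otimes> b) = marshall_class R S (a' \<otimes> b')"
      using 1 2 S(3) by (subst marshall_class_eq_iff) auto
  qed
  then show ?thesis
    unfolding marshall_quotient_def
    using UN_equiv_class2[OF equiv_marshall_rel equiv_marshall_rel] assms by simp
qed

lemma marshall_quotient_neg:
  assumes "a \<in> carrier R"
  shows "hneg (marshall_quotient R S) (marshall_class R S a) = marshall_class R S (\<ominus> a)"
proof -
  have "congruent (marshall_rel R S) (\<lambda>a. marshall_class R S (\<ominus> a))"
  proof (rule congruentI)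
    fix a b assume "(a, b) \<in> marshall_rel R S"
    then show "marshall_class R S (\<ominus> a) = marshall_class R S (\<ominus> b)"
      by (elim marshall_relE) (simp add: marshall_class_eq_iff, metis l_minus)
  qed
  then show ?thesis
    unfolding marshall_quotient_def using UN_equiv_class[OF equiv_marshall_rel] assms by simp
qed

lemma marshall_quotient_add:
  assumes ab: "a \<in> carrier R" "b \<in> carrier R"
  shows "hadd (marshall_quotient R S) (marshall_class R S a) (marshall_class R S b)
    = {marshall_class R S c | c. c \<in> carrier R \<and>
        (\<exists>r\<in>S. \<exists>s\<in>S. \<exists>t\<in>S. c \<otimes> r = a \<otimes> s \<oplus> b \<otimes> t)}"
proof -
  have "\<exists>r\<in>S. \<exists>s\<in>S. \<exists>t\<in>S. c \<otimes> r = a \<otimes> s \<oplus> b \<otimes> t"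
    if c: "c \<in> carrier R" and aa: "(a, a') \<in> marshall_rel R S" and bb: "(b, b') \<in> marshall_rel R S"
      and rst: "r \<in> S" "s \<in> S" "t \<in> S" "c \<otimes> r = a' \<otimes> s \<oplus> b' \<otimes> t" for c a' b' r s t
  proof -
    obtain x y where
      1: "a' \<in> carrier R" "x \<in> S" "y \<in> S" "x \<in> carrier R" "y \<in> carrier R" "a \<otimes> x = a' \<otimes> y"
      using aa by (elim marshall_relE) metis
    obtain z w where
      2: "b' \<in> carrier R" "z \<in> S" "w \<in> S" "z \<in> carrier R" "w \<in> carrier R" "b \<otimes> z = b' \<otimes> w"
      using bb by (elim marshall_relE) metis
    have 3: "r \<in> carrier R" "s \<in> carrier R" "t \<in> carrier R" using rst S(1) by auto
    have "c \<otimes> (r \<otimes> (y \<otimes> w)) = (c \<otimes> r) \<otimes> (y \<otimes> w)"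
      using c 1 2 3 by (simp add: m_assoc)
    also have "\<dots> = (a' \<otimes> y) \<otimes> (s \<otimes> w) \<oplus> (b' \<otimes> w) \<otimes> (t \<otimes> y)"
      unfolding rst(4) using 1(1-5) 2(1-5) 3 by (simp add: l_distr r_distr m_ac)
    also have "\<dots> = a \<otimes> (x \<otimes> (s \<otimes> w)) \<oplus> b \<otimes> (z \<otimes> (t \<otimes> y))"
      unfolding 1(6)[symmetric] 2(6)[symmetric] using 1(1-5) 2(1-5) 3 ab by (simp add: m_assoc)
    finally have "c \<otimes> (r \<otimes> (y \<otimes> w)) = a \<otimes> (x \<otimes> (s \<otimes> w)) \<oplus> b \<otimes> (z \<otimes> (t \<otimes> y))" .
    moreover have "r \<otimes> (y \<otimes> w) \<in> S" "x \<otimes> (s \<otimes> w) \<in> S" "z \<otimes> (t \<otimes> y) \<in> S"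
      using 1(2,3) 2(2,3) rst(1-3) by (simp_all add: S(3))
    ultimately show ?thesis by (intro bexI)
  qed
  note sub = this
  have self: "a \<in> marshall_class R S a" "b \<in> marshall_class R S b"
    using equiv_class_self[OF equiv_marshall_rel] ab by auto
  have "(\<exists>a'\<in>marshall_class R S a. \<exists>b'\<in>marshall_class R S b.
      \<exists>r\<in>S. \<exists>s\<in>S. \<exists>t\<in>S. c \<otimes> r = a' \<otimes> s \<oplus> b' \<otimes> t)
    \<longleftrightarrow> (\<exists>r\<in>S. \<exists>s\<in>S. \<exists>t\<in>S. c \<otimes> r = a \<otimes> s \<oplus> b \<otimes> t)" (is "?L \<longleftrightarrow> ?R") if "c \<in> carrier R" for c
  proof
    assume ?L
    then obtain a' b' r s t where "(a, a') \<in> marshall_rel R S" "(b, b') \<in> marshall_rel R S"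
      "r \<in> S" "s \<in> S" "t \<in> S" "c \<otimes> r = a' \<otimes> s \<oplus> b' \<otimes> t"
      by (elim bexE) (simp only: Image_singleton_iff)
    then show ?R by (rule sub[OF that])
  next
    assume ?R
    then show ?L by (intro bexI[OF bexI[OF _ self(2)] self(1)])
  qed
  then show ?thesis
    unfolding marshall_quotient_def by (simp only: multiring.simps cong: conj_cong)
qed

end

lemma unit_squares_submonoid:
  "unit_squares R \<subseteq> carrier R" "\<one> \<in> unit_squares R"
  "s \<in> unit_squares R \<Longrightarrow> t \<in> unit_squares R \<Longrightarrow> s \<otimes> t \<in> unit_squares R"
proof -
  show "unit_squares R \<subseteq> carrier R"
    unfolding unit_squares_def by auto
  have "\<one> [^] (2::nat) = \<one>" by simp
  then show "\<one> \<in> unit_squares R"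
    unfolding unit_squares_def using Units_one_closed by force
  assume "s \<in> unit_squares R" "t \<in> unit_squares R"
  then obtain u v where uv: "u \<in> Units R" "v \<in> Units R" "s = u [^] (2::nat)" "t = v [^] (2::nat)"
    unfolding unit_squares_def by auto
  then have "s \<otimes> t = (u \<otimes> v) [^] (2::nat)"
    by (simp add: nat_pow_distrib Units_closed)
  then show "s \<otimes> t \<in> unit_squares R"
    unfolding unit_squares_def using uv by auto
qed

end

end

theory Submission
  imports Defs "HOL-Number_Theory.Cong"
begin

text \<open>
  Since the elements of \<open>S\<^sub>n\<close> are units, an equation \<open>a s = b t\<close> with \<open>s, t \<in> S\<^sub>n\<close> preserves
  both being a unit and being zero. So whether a class lies in \<open>M(n)\<^sup>\<times> \<union> {[0]}\<close> can be read off any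
  representative: the set consists of the classes of the elements of \<open>V = \<int>\<^sub>n\<^sup>\<times> \<union> {0}\<close>.

  As \<open>[a + b] \<in> [a] + [b]\<close>, a submultiring structure makes \<open>V\<close> closed under addition. But
  \<open>1 \<in> V\<close>, and \<open>\<int>\<^sub>n\<close> consists of the sums \<open>1 + \<dots> + 1\<close>; hence \<open>V = \<int>\<^sub>n\<close>. Conversely, if
  \<open>V = \<int>\<^sub>n\<close>, then \<open>M(n)\<^sup>\<times> \<union> {[0]}\<close> is all of \<open>M(n)\<close>, which is trivially a submultiring. So the
  condition says that every nonzero element of \<open>\<int>\<^sub>n\<close> is a unit
  (\<open>submultiring_units_zero_iff\<close>, which holds for every multiplicatively closed set \<open>S\<close> of units
  containing \<open>1\<close>, in any commutative ring that consists of sums of copies of \<open>1\<close>). That is the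
  case exactly when every integer is either coprime to \<open>n\<close> or a multiple of \<open>n\<close>, and testing
  this on the divisors of \<open>n\<close> shows that \<open>n\<close> is \<open>1\<close> or prime.
\<close>

section \<open>Unit classes in a Marshall quotient by units\<close>

context cring
begin

context
  fixes S
  assumes S: "S \<subseteq> Units R" "\<one> \<in> S" "\<And>s t. s \<in> S \<Longrightarrow> t \<in> S \<Longrightarrow> s \<otimes> t \<in> S"
begin

private lemma S_carrier: "S \<subseteq> carrier R"
  using S(1) by auto

private lemmas class_eq_iff = marshall_class_eq_iff[OF S_carrier S(2,3)]

lemma marshall_class_eq_zero_iff:
  assumes "a \<in> carrier R"
  shows "marshall_class R S a = marshall_class R S \<zero> \<longleftrightarrow> a = \<zero>"
proof
  assume "marshall_class R S a = marshall_class R S \<zero>"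
  then obtain s t where st: "s \<in> S" "t \<in> S" "a \<otimes> s = \<zero> \<otimes> t"
    using assms by (auto simp: class_eq_iff)
  have "s \<in> Units R" "t \<in> carrier R" using st S by auto
  then have "a \<otimes> s \<otimes> inv s = \<zero>" using st(3) by simp
  then show "a = \<zero>"
    using assms \<open>s \<in> Units R\<close> by (simp add: m_assoc Units_closed)
qed simp

text \<open>
  An inverse \<open>[b]\<close> of \<open>[a]\<close> need not come from an inverse \<open>b\<close> of \<open>a\<close>: it only gives \<open>a b s = t\<close>
  with \<open>s, t \<in> S\<close>. But then \<open>a\<close> divides the unit \<open>t\<close>.
\<close>

lemma marshall_class_mem_Units_iff:
  assumes a: "a \<in> carrier R"
  shows "marshall_class R S a \<in> Units (marshall_quotient R S) \<longleftrightarrow> a \<in> Units R"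
proof
  assume "marshall_class R S a \<in> Units (marshall_quotient R S)"
  then obtain B where B: "B \<in> carrier R // marshall_rel R S"
    "marshall_class R S a \<otimes>\<^bsub>marshall_quotient R S\<^esub> B = marshall_class R S \<one>"
    by (auto simp: Units_def marshall_quotient_def)
  from B(1) obtain b where b: "b \<in> carrier R" "B = marshall_class R S b"
    by (auto elim: quotientE)
  then have "marshall_class R S (a \<otimes> b) = marshall_class R S \<one>"
    using B(2) a marshall_quotient_mult[OF S_carrier S(2,3) a b(1)] by simp
  then obtain s t where st: "s \<in> S" "t \<in> S" "a \<otimes> b \<otimes> s = \<one> \<otimes> t"
    using a b by (auto simp: class_eq_iff)
  have st': "s \<in> carrier R" "t \<in> Units R" using st S by auto
  have "a \<otimes> (b \<otimes> s \<otimes> inv t) = a \<otimes> b \<otimes> s \<otimes> inv t"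
    using a b st' by (simp add: m_assoc)
  also have "\<dots> = \<one>"
    using st(3) st' by (simp add: Units_closed)
  finally have "a \<otimes> (b \<otimes> s \<otimes> inv t) = \<one>" .
  moreover have "b \<otimes> s \<otimes> inv t \<in> carrier R"
    using b st' by simp
  ultimately show "a \<in> Units R"
    using a m_comm unfolding Units_def by fastforce
next
  assume u: "a \<in> Units R"
  then have i: "inv a \<in> carrier R" by simp
  have "marshall_class R S a \<in> carrier R // marshall_rel R S"
    "marshall_class R S (inv a) \<in> carrier R // marshall_rel R S"
    using a i by (auto intro: quotientI)
  moreover have
    "marshall_class R S a \<otimes>\<^bsub>marshall_quotient R S\<^esub> marshall_class R S (inv a) = marshall_class R S \<one>"
    "marshall_class R S (inv a) \<otimes>\<^bsub>marshall_quotient R S\<^esub> marshall_class R S a = marshall_class R S \<one>"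
    using marshall_quotient_mult[OF S_carrier S(2,3)] a i u by simp_all
  ultimately show "marshall_class R S a \<in> Units (marshall_quotient R S)"
    unfolding Units_def by (auto simp: marshall_quotient_def)
qed

lemma marshall_class_mem_units_zero_iff:
  assumes "a \<in> carrier R"
  shows "marshall_class R S a \<in>
      Units (marshall_quotient R S) \<union> {hzero (marshall_quotient R S)}
    \<longleftrightarrow> a \<in> Units R \<union> {\<zero>}"
  using marshall_class_mem_Units_iff[OF assms] marshall_class_eq_zero_iff[OF assms]
  by (auto simp: marshall_quotient_def)

lemma submultiring_carrier_marshall_quotient:
  "submultiring (carrier (marshall_quotient R S)) (marshall_quotient R S)"
proof -
  let ?M = "marshall_quotient R S"
  have M: "carrier ?M = carrier R // marshall_rel R S" "\<one>\<^bsub>?M\<^esub> = marshall_class R S \<one>"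
    "hzero ?M = marshall_class R S \<zero>"
    by (simp_all add: marshall_quotient_def)
  have cl: "marshall_class R S a \<in> carrier ?M" if "a \<in> carrier R" for a
    using that by (auto simp: M intro: quotientI)
  have ex: "\<exists>a\<in>carrier R. A = marshall_class R S a" if "A \<in> carrier ?M" for A
    using that by (auto simp: M elim: quotientE)
  have "A \<otimes>\<^bsub>?M\<^esub> B \<in> carrier ?M" if AB: "A \<in> carrier ?M" "B \<in> carrier ?M" for A B
  proof -
    obtain a b where "a \<in> carrier R" "A = marshall_class R S a"
        "b \<in> carrier R" "B = marshall_class R S b"
      using ex AB by blast
    then show ?thesis by (simp only: marshall_quotient_mult[OF S_carrier S(2,3)] cl m_closed)
  qed
  moreover have "hneg ?M A \<in> carrier ?M" if A: "A \<in> carrier ?M" for A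
  proof -
    obtain a where "a \<in> carrier R" "A = marshall_class R S a"
      using ex A by blast
    then show ?thesis by (simp only: marshall_quotient_neg[OF S_carrier S(2,3)] cl a_inv_closed)
  qed
  moreover have "hadd ?M A B \<subseteq> carrier ?M" for A B
    using cl by (auto simp: marshall_quotient_def)
  ultimately show ?thesis
    unfolding submultiring_def M(2,3) using cl by blast
qed

text \<open>
  For the forward direction only the sums \<open>a + b\<close> with trivial factors from \<open>S\<close> matter, and
  \<open>1 + \<dots> + 1\<close> is reached from \<open>0\<close> by adding the unit \<open>1\<close> repeatedly.
\<close>

proposition submultiring_units_zero_iff:
  assumes gen: "carrier R = range (\<lambda>k::nat. [k] \<cdot> \<one>)"
  shows "submultiring (Units (marshall_quotient R S) \<union> {hzero (marshall_quotient R S)})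
      (marshall_quotient R S)
    \<longleftrightarrow> carrier R = Units R \<union> {\<zero>}"
proof
  let ?M = "marshall_quotient R S"
  let ?U = "Units ?M \<union> {hzero ?M}"
  assume sub: "submultiring ?U ?M"
  have add: "a \<oplus> b \<in> Units R \<union> {\<zero>}"
    if "a \<in> Units R \<union> {\<zero>}" "b \<in> Units R \<union> {\<zero>}" for a b
  proof -
    have ab: "a \<in> carrier R" "b \<in> carrier R" using that by auto
    then have "marshall_class R S a \<in> ?U" "marshall_class R S b \<in> ?U"
      using that marshall_class_mem_units_zero_iff by blast+
    then have "hadd ?M (marshall_class R S a) (marshall_class R S b) \<subseteq> ?U"
      using sub unfolding submultiring_def by blast
    moreover have "marshall_class R S (a \<oplus> b) \<in>
        hadd ?M (marshall_class R S a) (marshall_class R S b)"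
    proof -
      have "\<exists>r\<in>S. \<exists>s\<in>S. \<exists>t\<in>S. (a \<oplus> b) \<otimes> r = a \<otimes> s \<oplus> b \<otimes> t"
        using ab by (intro bexI[of _ \<one>] S(2)) simp
      moreover have "a \<oplus> b \<in> carrier R" using ab by simp
      ultimately have "marshall_class R S (a \<oplus> b) \<in> {marshall_class R S c | c. c \<in> carrier R \<and>
          (\<exists>r\<in>S. \<exists>s\<in>S. \<exists>t\<in>S. c \<otimes> r = a \<otimes> s \<oplus> b \<otimes> t)}"
        unfolding mem_Collect_eq by (intro exI[of _ "a \<oplus> b"] conjI refl)
      then show ?thesis
        using marshall_quotient_add[OF S_carrier S(2,3) ab] by (simp only:)
    qed
    ultimately show ?thesis
      using marshall_class_mem_units_zero_iff ab by blast
  qed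
  have "[k] \<cdot> \<one> \<in> Units R \<union> {\<zero>}" for k :: nat
  proof (induction k)
    case (Suc k)
    then show ?case using add[of "[k] \<cdot> \<one>" \<one>] by simp
  qed simp
  then show "carrier R = Units R \<union> {\<zero>}"
    using gen by auto
next
  let ?M = "marshall_quotient R S"
  assume R: "carrier R = Units R \<union> {\<zero>}"
  have "carrier ?M \<subseteq> Units ?M \<union> {hzero ?M}"
  proof
    fix A assume "A \<in> carrier ?M"
    then obtain a where "a \<in> carrier R" "A = marshall_class R S a"
      by (auto simp: marshall_quotient_def elim: quotientE)
    then show "A \<in> Units ?M \<union> {hzero ?M}"
      using R marshall_class_mem_units_zero_iff by blast
  qed
  then have "Units ?M \<union> {hzero ?M} = carrier ?M"
    using submultiring_carrier_marshall_quotient by (auto simp: submultiring_def Units_def)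
  then show "submultiring (Units ?M \<union> {hzero ?M}) ?M"
    using submultiring_carrier_marshall_quotient by simp
qed

end

lemma unit_squares_subset_Units: "unit_squares R \<subseteq> Units R"
  by (auto simp: unit_squares_def numeral_2_eq_2)

end

section \<open>Units of the integers modulo \<open>m\<close>\<close>

lemma carrier_ZFact: "carrier (ZFact m) = range (ZMod m)"
  by (auto simp: ZFact_defs A_RCOSETS_def' ZMod_def)

lemma ring_hom_ZMod: "ZMod m \<in> ring_hom \<Z> (ZFact m)"
proof -
  have "ideal (Idl\<^bsub>\<Z>\<^esub> {m}) \<Z>"
    by (rule int.genideal_ideal) simp
  from ideal.rcos_ring_hom[OF this] show ?thesis
    unfolding ZFact_def ZMod_def .
qed

lemma ZFact_mult: "ZMod m a \<otimes>\<^bsub>ZFact m\<^esub> ZMod m b = ZMod m (a * b)"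
  using ring_hom_mult[OF ring_hom_ZMod, of a b] by simp

lemma ZFact_add: "ZMod m a \<oplus>\<^bsub>ZFact m\<^esub> ZMod m b = ZMod m (a + b)"
  using ring_hom_add[OF ring_hom_ZMod, of a b] by simp

lemma ZFact_one_eq: "\<one>\<^bsub>ZFact m\<^esub> = ZMod m 1"
  using ring_hom_one[OF ring_hom_ZMod] by simp

lemma ZFact_zero_eq: "\<zero>\<^bsub>ZFact m\<^esub> = ZMod m 0"
  using ring_hom_zero[OF ring_hom_ZMod int.ring_axioms cring.axioms(1)[OF ZFact_is_cring]] by simp

lemma ZFact_add_pow_one: "[k] \<cdot>\<^bsub>ZFact m\<^esub> \<one>\<^bsub>ZFact m\<^esub> = ZMod m (int k)"
proof -
  interpret cring "ZFact m" by (rule ZFact_is_cring)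
  show ?thesis
    by (induction k) (simp_all add: ZFact_zero_eq ZFact_one_eq ZFact_add add.commute)
qed

lemma carrier_ZFact_eq_add_pow_one:
  assumes "m > 0"
  shows "carrier (ZFact m) = range (\<lambda>k::nat. [k] \<cdot>\<^bsub>ZFact m\<^esub> \<one>\<^bsub>ZFact m\<^esub>)"
proof -
  have "ZMod m a = ZMod m (int (nat (a mod m)))" for a
    using assms by (simp add: ZMod_eq_mod)
  then show ?thesis
    unfolding carrier_ZFact ZFact_add_pow_one by (blast intro: range_eqI)
qed

lemma ZMod_mem_Units_iff: "ZMod m a \<in> Units (ZFact m) \<longleftrightarrow> coprime a m"
proof -
  interpret cring "ZFact m" by (rule ZFact_is_cring)
  have "ZMod m a \<in> Units (ZFact m) \<longleftrightarrow> (\<exists>b. [a * b = 1] (mod m))"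
    unfolding Units_def carrier_ZFact
    by (auto simp: ZFact_mult ZFact_one_eq ZMod_eq_mod cong_def mult.commute)
  then show ?thesis
    by (simp add: coprime_iff_invertible_int)
qed

lemma ZMod_eq_zero_iff: "ZMod m a = \<zero>\<^bsub>ZFact m\<^esub> \<longleftrightarrow> m dvd a"
  by (simp add: ZFact_zero_eq ZMod_eq_mod dvd_eq_mod_eq_0)

section \<open>Moduli for which every nonzero residue is a unit\<close>

lemma all_coprime_or_dvd_iff:
  fixes n :: nat
  assumes "n \<ge> 1"
  shows "(\<forall>a::int. coprime a (int n) \<or> int n dvd a) \<longleftrightarrow> n = 1 \<or> Factorial_Ring.prime n"
proof
  assume *: "\<forall>a::int. coprime a (int n) \<or> int n dvd a"
  have "d = 1 \<or> d = n" if "d dvd n" for d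
  proof -
    have "coprime d n \<or> n dvd d"
      using *[rule_format, of "int d"] by (simp)
    then show ?thesis
      using that by (metis coprime_common_divisor dvd_antisym dvd_refl nat_dvd_1_iff_1)
  qed
  then show "n = 1 \<or> Factorial_Ring.prime n"
    using assms prime_nat_iff[of n] by (cases "n = 1") auto
next
  assume "n = 1 \<or> Factorial_Ring.prime n"
  then show "\<forall>a::int. coprime a (int n) \<or> int n dvd a"
    using prime_imp_coprime[of "int n"] by (auto simp: coprime_commute)
qed

theorem theorem5p12:
  fixes n :: nat
  assumes "n \<ge> 1"
  shows "submultiring (\<U> n) (\<M> n) \<longleftrightarrow> n = 1 \<or> Factorial_Ring.prime n"
proof -
  interpret cring "ZFact (int n)" by (rule ZFact_is_cring)
  have "submultiring (\<U> n) (\<M> n) \<longleftrightarrow>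
      carrier (ZFact (int n)) = Units (ZFact (int n)) \<union> {\<zero>\<^bsub>ZFact (int n)\<^esub>}"
    unfolding \<U>_def \<M>_def
    using assms
    by (intro submultiring_units_zero_iff unit_squares_subset_Units unit_squares_submonoid
        carrier_ZFact_eq_add_pow_one) auto
  also have "\<dots> \<longleftrightarrow> carrier (ZFact (int n)) \<subseteq> Units (ZFact (int n)) \<union> {\<zero>\<^bsub>ZFact (int n)\<^esub>}"
    by auto
  also have "\<dots> \<longleftrightarrow> (\<forall>a. coprime a (int n) \<or> int n dvd a)"
    unfolding carrier_ZFact by (auto simp: image_subset_iff ZMod_mem_Units_iff ZMod_eq_zero_iff)
  also have "\<dots> \<longleftrightarrow> n = 1 \<or> Factorial_Ring.prime n"
    using assms by (rule all_coprime_or_dvd_iff)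
  finally show ?thesis .
qed

end
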